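(* Every submonoid of the additive monoid $\langle 1/p \mid p \in \mathbb{P} \rangle$ satisfies the ACCP.
   Context: $\mathbb{P}$ is the set of prime numbers, and $\langle 1/p \mid p \in \mathbb{P} \rangle$ is the additive submonoid of $\mathbb{Q}_{\ge 0}$ generated by $\{1/p \mid p \in \mathbb{P}\}$. A principal ideal of an additive monoid $M$ is a subset of the form $x + M$ with $x \in M$; $M$ satisfies the ACCP (ascending chain condition on principal ideals) if every increasing (under inclusion) sequence of principal ideals of $M$ eventually stabilizes. *)

theory Defs
  imports Complex_Main "HOL-Algebra.Coset" "HOL-Computational_Algebra.Primes"
begin

text \<open>The additive monoid of nonnegative rationals. The record type \<open>monoid\<close> of HOL-Algebra is
  written multiplicatively, so \<open>\<otimes>\<close> and \<open>\<one>\<close> of this structure are \<open>+\<close> and \<open>0\<close>.\<close>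

definition nonneg_rat_monoid :: "rat monoid" where
  "nonneg_rat_monoid = \<lparr>carrier = {q. 0 \<le> q}, monoid.mult = (+), one = 0\<rparr>"

lemma comm_monoid_nonneg_rat_monoid: "comm_monoid nonneg_rat_monoid"
  by (rule comm_monoidI) (auto simp: nonneg_rat_monoid_def)

text \<open>The library's \<open>generate\<close> yields generated subgroups, hence the hull (the least
  submonoid containing \<open>S\<close>).\<close>

definition generated_submonoid :: "('a, 'b) monoid_scheme \<Rightarrow> 'a set \<Rightarrow> ('a, 'b) monoid_scheme" where
  "generated_submonoid M S = M\<lparr>carrier := (\<lambda>H. submonoid H M) hull S\<rparr>"

lemma submonoid_generated_submonoid:
  assumes "monoid M" "S \<subseteq> carrier M"
  shows "submonoid (carrier (generated_submonoid M S)) M" "S \<subseteq> carrier (generated_submonoid M S)"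
proof -
  interpret monoid M by fact
  have whole: "submonoid (carrier M) M" by unfold_locales auto
  show "submonoid (carrier (generated_submonoid M S)) M"
  proof (rule submonoid.intro)
    show "carrier (generated_submonoid M S) \<subseteq> carrier M"
      using whole assms(2) by (auto simp: generated_submonoid_def hull_def)
    show "x \<otimes>\<^bsub>M\<^esub> y \<in> carrier (generated_submonoid M S)"
      if "x \<in> carrier (generated_submonoid M S)" "y \<in> carrier (generated_submonoid M S)" for x y
      using that by (auto simp: generated_submonoid_def hull_def intro: submonoid.m_closed)
    show "\<one>\<^bsub>M\<^esub> \<in> carrier (generated_submonoid M S)"
      by (auto simp: generated_submonoid_def hull_def intro: submonoid.one_closed)
  qed
  show "S \<subseteq> carrier (generated_submonoid M S)"
    by (simp add: generated_submonoid_def hull_subset)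
qed

definition prime_reciprocal_monoid :: "rat monoid" where
  "prime_reciprocal_monoid =
     generated_submonoid nonneg_rat_monoid {1 / of_nat p | p :: nat. prime p}"

text \<open>For commutative monoids; the principal ideal of \<open>x\<close> is the coset
  \<open>x <# carrier M\<close>, that is \<open>x + M\<close> in additive notation.\<close>

definition principal_monoid_ideal :: "('a, 'b) monoid_scheme \<Rightarrow> 'a set \<Rightarrow> bool" where
  "principal_monoid_ideal M I \<longleftrightarrow> (\<exists>x \<in> carrier M. I = x <#\<^bsub>M\<^esub> carrier M)"

definition ACCP :: "('a, 'b) monoid_scheme \<Rightarrow> bool" where
  "ACCP M \<longleftrightarrow>
     (\<forall>I :: nat \<Rightarrow> 'a set. (\<forall>n. principal_monoid_ideal M (I n)) \<and> incseq I \<longrightarrow>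
        (\<exists>N. \<forall>n \<ge> N. I n = I N))"

end

theory Submission
  imports Defs
begin

text \<open>Every element \<open>x\<close> of \<open>\<langle>1/p\<rangle>\<close> is \<open>k + \<Sum>\<^sub>p c\<^sub>p / p\<close> with \<open>k\<close> a natural number; take \<open>k\<close>
  maximal. Then \<open>c\<^sub>p < p\<close> for all \<open>p\<close>, as \<open>p\<close> summands \<open>1/p\<close> make up a further unit, and since \<open>x\<close>
  determines \<open>c\<^sub>p\<close> modulo \<open>p\<close>, the \<open>c\<^sub>p\<close> are unique. If \<open>x = y + d\<close> with \<open>d \<noteq> 0\<close>, then passing from
  \<open>x\<close> to \<open>y\<close> either decreases \<open>k\<close>, or keeps it and decreases \<open>\<Sum>\<^sub>p c\<^sub>p\<close>. So the lexicographically
  ordered pair \<open>(k, \<Sum>\<^sub>p c\<^sub>p)\<close> drops along every proper divisibility, whatever the submonoid in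
  which divisibility is taken.\<close>

definition recip_sum :: "nat multiset \<Rightarrow> rat" where
  "recip_sum A = (\<Sum>p\<in>#A. 1 / of_nat p)"

lemma recip_sum_empty [simp]: "recip_sum {#} = 0"
  by (simp add: recip_sum_def)

lemma recip_sum_add_mset [simp]: "recip_sum (add_mset p A) = 1 / of_nat p + recip_sum A"
  by (simp add: recip_sum_def)

lemma recip_sum_union [simp]: "recip_sum (A + B) = recip_sum A + recip_sum B"
  by (simp add: recip_sum_def)

lemma recip_sum_replicate [simp]: "recip_sum (replicate_mset n p) = of_nat n / of_nat p"
  by (induction n) (simp_all add: add_divide_distrib)

lemma recip_sum_nonneg: "0 \<le> recip_sum A"
  by (induction A) auto

text \<open>This isolates the \<open>p\<close>-part of the sum: summands \<open>1/q\<close> with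
  \<open>q \<noteq> p\<close> only contribute factors prime to \<open>p\<close> to the common
  denominator \<open>b\<close>.\<close>

lemma recip_sum_split:
  assumes "prime p" "\<forall>q\<in>#A. prime q"
  shows "\<exists>a b. coprime b p \<and> b \<noteq> 0 \<and>
           recip_sum A = of_nat (count A p) / of_nat p + of_nat a / of_nat b"
  using assms(2)
proof (induction A)
  case empty
  show ?case by (intro exI[of _ 0] exI[of _ 1]) simp
next
  case (add q A)
  then obtain a b where ab: "coprime b p" "b \<noteq> 0"
    "recip_sum A = of_nat (count A p) / of_nat p + of_nat a / of_nat b"
    by auto
  show ?case
  proof (cases "q = p")
    case True
    with ab show ?thesis
      by (intro exI[of _ a] exI[of _ b]) (simp add: add_divide_distrib)
  next
    case False
    have "prime q" using add.prems by simp
    then have "coprime q p" "q \<noteq> 0"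
      using False assms(1) primes_coprime prime_gt_0_nat by auto
    with ab False show ?thesis
      \<comment> \<open>The witnesses come from
        \<open>1/q + a/b = (b + a * q) / (b * q)\<close>.\<close>
      by (intro exI[of _ "b + a * q"] exI[of _ "b * q"]) (simp add: add_divide_distrib)
  qed
qed

lemma recip_sum_eq_imp_count_mod_eq:
  assumes p: "prime p" and "\<forall>q\<in>#A. prime q" "\<forall>q\<in>#B. prime q" and eq: "recip_sum A = recip_sum B"
  shows "count A p mod p = count B p mod p"
proof -
  obtain a b where ab: "coprime b p" "b \<noteq> 0"
    "recip_sum A = of_nat (count A p) / of_nat p + of_nat a / of_nat b"
    using recip_sum_split assms by blast
  obtain c d where cd: "coprime d p" "d \<noteq> 0"
    "recip_sum B = of_nat (count B p) / of_nat p + of_nat c / of_nat d"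
    using recip_sum_split assms by blast
  have "p \<noteq> 0" using p by auto
  \<comment> \<open>Both sums are multiplied by the common denominator \<open>p * b * d\<close>. The
    result is cast from the integers, so that the counts can be subtracted afterwards.\<close>
  have "(of_int (int (count A p) * int b * int d + int a * int p * int d) :: rat)
        = recip_sum A * (of_nat p * of_nat b * of_nat d)"
    unfolding ab(3) using ab(2) \<open>p \<noteq> 0\<close> by (simp add: distrib_right)
  also have "\<dots> = recip_sum B * (of_nat p * of_nat b * of_nat d)"
    by (simp only: eq)
  also have "\<dots> = of_int (int (count B p) * int b * int d + int c * int p * int b)"
    unfolding cd(3) using cd(2) \<open>p \<noteq> 0\<close> by (simp add: distrib_right)
  finally have "int (count A p) * int b * int d + int a * int p * int d
        = int (count B p) * int b * int d + int c * int p * int b"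
    by (simp only: of_int_eq_iff)
  then have "(int (count A p) - int (count B p)) * (int b * int d)
        = int p * (int c * int b - int a * int d)"
    by (simp add: algebra_simps)
  then have "int p dvd (int (count A p) - int (count B p)) * (int b * int d)"
    by simp
  moreover have "coprime (int p) (int b * int d)"
    using ab(1) cd(1) by (simp add: coprime_commute)
  ultimately have "int p dvd int (count A p) - int (count B p)"
    using coprime_dvd_mult_left_iff by blast
  then show ?thesis
    by (metis mod_eq_dvd_iff of_nat_eq_iff of_nat_mod)
qed

text \<open>Multiplicities in \<open>A\<close> may exceed \<open>p\<close>, so \<open>k\<close> is
  not determined by \<open>x\<close>; in particular \<open>k = 0\<close> already covers all sums of
  prime reciprocals.\<close>

definition unit_decomp :: "rat \<Rightarrow> nat \<Rightarrow> nat multiset \<Rightarrow> bool" where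
  "unit_decomp x k A \<longleftrightarrow> (\<forall>p\<in>#A. prime p) \<and> x = of_nat k + recip_sum A"

definition max_units :: "rat \<Rightarrow> nat" where
  "max_units x = (GREATEST k. \<exists>A. unit_decomp x k A)"

definition rest_size :: "rat \<Rightarrow> nat" where
  "rest_size x = size (SOME A. unit_decomp x (max_units x) A)"

text \<open>An upper bound on \<open>k\<close> is what makes the \<open>GREATEST\<close> in
  \<open>max_units\<close> meaningful.\<close>

lemma unit_decomp_bound:
  assumes "unit_decomp x k A"
  shows "k \<le> nat \<lfloor>x\<rfloor>"
proof -
  have "of_nat k \<le> x"
    using assms recip_sum_nonneg[of A] by (simp add: unit_decomp_def)
  then show ?thesis
    by (metis floor_mono floor_of_nat nat_int nat_mono)
qed

lemma max_units_ge: "unit_decomp x k A \<Longrightarrow> k \<le> max_units x"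
  unfolding max_units_def by (rule Greatest_le_nat[of _ _ "nat \<lfloor>x\<rfloor>"]) (use unit_decomp_bound in blast)+

lemma max_units_attained: "unit_decomp x k A \<Longrightarrow> \<exists>B. unit_decomp x (max_units x) B"
  unfolding max_units_def
  by (rule GreatestI_nat[of "\<lambda>k. \<exists>A. unit_decomp x k A" k "nat \<lfloor>x\<rfloor>"])
    (use unit_decomp_bound in blast)+

lemma count_less_if_max_units:
  assumes dec: "unit_decomp x (max_units x) A" and p: "prime p"
  shows "count A p < p"
proof (rule ccontr)
  assume "\<not> count A p < p"
  then have "replicate_mset p p \<subseteq># A"
    by (simp flip: count_le_replicate_mset_subset_eq)
  then obtain B where B: "A = replicate_mset p p + B"
    by (auto simp: subset_mset.le_iff_add)
  have "p \<noteq> 0" using p by auto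
  \<comment> \<open>The \<open>p\<close> copies of \<open>1/p\<close> removed from \<open>A\<close>
    are traded for one unit, against maximality.\<close>
  then have "unit_decomp x (Suc (max_units x)) B"
    using dec by (auto simp: unit_decomp_def B)
  from max_units_ge[OF this] show False by simp
qed

lemma max_units_decomp_unique:
  assumes A: "unit_decomp x (max_units x) A" and B: "unit_decomp x (max_units x) B"
  shows "A = B"
proof (rule multiset_eqI)
  fix p
  show "count A p = count B p"
  proof (cases "prime p")
    case True
    have "count A p mod p = count B p mod p"
      using A B True by (intro recip_sum_eq_imp_count_mod_eq) (auto simp: unit_decomp_def)
    then show ?thesis
      using count_less_if_max_units[OF A True] count_less_if_max_units[OF B True] by simp
  next
    case False
    then show ?thesis
      using A B by (metis not_in_iff unit_decomp_def)
  qed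
qed

text \<open>By uniqueness, the choice made by \<open>SOME\<close> in \<open>rest_size\<close> is
  immaterial.\<close>

lemma rest_size_eq:
  assumes "unit_decomp x (max_units x) A"
  shows "rest_size x = size A"
  unfolding rest_size_def
  using max_units_decomp_unique[OF assms someI[of "unit_decomp x (max_units x)", OF assms]] by simp

definition divisor_order :: "(rat \<times> rat) set" where
  "divisor_order = inv_image (less_than <*lex*> less_than) (\<lambda>x. (max_units x, rest_size x))"

lemma wf_divisor_order: "wf divisor_order"
  unfolding divisor_order_def by (intro wf_inv_image wf_lex_prod wf_less_than)

lemma proper_divisor_less:
  assumes y: "unit_decomp y k A" and d: "unit_decomp d 0 B" "d \<noteq> 0"
  shows "(y, y + d) \<in> divisor_order"
proof -
  obtain C where C: "unit_decomp y (max_units y) C"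
    using max_units_attained[OF y] by blast
  \<comment> \<open>Hence \<open>max_units\<close> cannot drop from \<open>y\<close> to
    \<open>y + d\<close>. If it stays equal, \<open>C + B\<close> is the maximal decomposition of
    \<open>y + d\<close>, larger than \<open>C\<close> by the nonempty \<open>B\<close>.\<close>
  have CB: "unit_decomp (y + d) (max_units y) (C + B)"
    using C d(1) by (auto simp: unit_decomp_def)
  have "B \<noteq> {#}"
    using d by (auto simp: unit_decomp_def)
  show ?thesis
  proof (cases "max_units y = max_units (y + d)")
    case True
    then have "rest_size (y + d) = size C + size B"
      using rest_size_eq CB by simp
    with True rest_size_eq[OF C] \<open>B \<noteq> {#}\<close> show ?thesis
      by (simp add: divisor_order_def nonempty_has_size)
  next
    case False
    with max_units_ge[OF CB] show ?thesis
      by (simp add: divisor_order_def)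
  qed
qed

lemma carrier_prime_reciprocal_monoid_decomp:
  assumes "x \<in> carrier prime_reciprocal_monoid"
  shows "\<exists>A. unit_decomp x 0 A"
proof -
  let ?H = "{x. \<exists>A. unit_decomp x 0 A}"
  have "submonoid ?H nonneg_rat_monoid"
  proof (rule submonoid.intro)
    show "?H \<subseteq> carrier nonneg_rat_monoid"
      by (auto simp: unit_decomp_def nonneg_rat_monoid_def recip_sum_nonneg)
    show "x \<otimes>\<^bsub>nonneg_rat_monoid\<^esub> y \<in> ?H" if H: "x \<in> ?H" "y \<in> ?H" for x y
    proof -
      obtain A B where "unit_decomp x 0 A" "unit_decomp y 0 B"
        using H by auto
      then have "unit_decomp (x + y) 0 (A + B)"
        by (auto simp: unit_decomp_def)
      then show ?thesis
        by (auto simp: nonneg_rat_monoid_def)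
    qed
    have "unit_decomp 0 0 {#}"
      by (simp add: unit_decomp_def)
    then show "\<one>\<^bsub>nonneg_rat_monoid\<^esub> \<in> ?H"
      by (auto simp: nonneg_rat_monoid_def)
  qed
  moreover have "unit_decomp (1 / of_nat p) 0 {#p#}" if "prime p" for p
    using that by (simp add: unit_decomp_def)
  then have "{1 / of_nat p | p :: nat. prime p} \<subseteq> ?H"
    by blast
  ultimately have "(\<lambda>H. submonoid H nonneg_rat_monoid) hull {1 / of_nat p | p :: nat. prime p} \<subseteq> ?H"
    by (intro hull_minimal)
  with assms show ?thesis
    by (auto simp: prime_reciprocal_monoid_def generated_submonoid_def)
qed

theorem theorem4p5:
  fixes N :: "rat set"
  assumes "submonoid N prime_reciprocal_monoid"
  shows "ACCP (prime_reciprocal_monoid\<lparr>carrier := N\<rparr>)"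
proof -
  let ?M = "prime_reciprocal_monoid\<lparr>carrier := N\<rparr>"
  have mult: "x \<otimes>\<^bsub>prime_reciprocal_monoid\<^esub> y = x + y" for x y
    by (simp add: prime_reciprocal_monoid_def generated_submonoid_def nonneg_rat_monoid_def)
  have coset: "x <#\<^bsub>prime_reciprocal_monoid\<^esub> N = (+) x ` N" for x
    by (auto simp: l_coset_def mult)
  have zero: "0 \<in> N"
    using submonoid.one_closed[OF assms]
    by (simp add: prime_reciprocal_monoid_def generated_submonoid_def nonneg_rat_monoid_def)
  have decomp: "\<exists>A. unit_decomp x 0 A" if "x \<in> N" for x
    using that submonoid.subset[OF assms] carrier_prime_reciprocal_monoid_decomp by blast
  show ?thesis
    unfolding ACCP_def
  proof (intro allI impI, elim conjE)
    fix I :: "nat \<Rightarrow> rat set"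
    assume "\<forall>n. principal_monoid_ideal ?M (I n)" and I: "incseq I"
    then have "\<forall>n. \<exists>x\<in>N. I n = (+) x ` N"
      by (simp add: principal_monoid_ideal_def coset)
    then obtain x where x: "\<And>n. x n \<in> N" "\<And>n. I n = (+) (x n) ` N"
      by metis
    \<comment> \<open>The chain is stationary from an index whose generator is minimal among all
      generators.\<close>
    obtain z where "z \<in> range x" and min: "\<And>y. (y, z) \<in> divisor_order \<Longrightarrow> y \<notin> range x"
      using wfE_min[OF wf_divisor_order, of "x 0" "range x"] by blast
    then obtain m where m: "z = x m" by blast
    have "I n = I m" if "n \<ge> m" for n
    proof -
      have "x m \<in> I m"
        unfolding x(2) using zero by (force intro: image_eqI[of _ _ 0])
      then have "x m \<in> I n"
        using I that by (auto simp: incseq_def)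
      then obtain d where d: "d \<in> N" "x m = x n + d"
        unfolding x(2) by blast
      \<comment> \<open>Otherwise \<open>x n\<close> would lie strictly below the minimal
        \<open>x m\<close>.\<close>
      have "d = 0"
        using proper_divisor_less decomp[OF x(1)[of n]] decomp[OF d(1)] min[of "x n"] m d(2)
        by (metis rangeI)
      with d x(2) show ?thesis by simp
    qed
    then show "\<exists>m. \<forall>n\<ge>m. I n = I m" by blast
  qed
qed

end
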